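(* Let $K$ be an algebraically closed field of characteristic $0$. Let $f(x)=Ax^{n_1}+Bx^{n_2}+Cx^{n_3}+D$ with $A,B,C,D\in K$, $ABC\neq 0$, and integers $n_1>n_2>n_3>0$. Suppose that $f(x)=g(h(x))$ for some $g,h\in K[x]$. Then one of the following cases holds: (1) $g(x)=\left(Ax^{n_1/d}+Bx^{n_2/d}+Cx^{n_3/d}+D\right)\circ l^{-1}$ and $h(x)=l\circ x^d$ for some linear polynomial $l\in K[x]$ and some positive integer $d\mid\gcd(n_1,n_2,n_3)$; (2) $g(x)=l(x)$ and $h(x)=l^{-1}\circ f(x)$ for some linear polynomial $l\in K[x]$; (3) $g(x)=(Ax^2+D)\circ l$ and $h(x)=l^{-1}\circ\left(x^{n_1/2}+\frac{B}{2A}x^{n_3/2}\right)$ for some linear polynomial $l\in K[x]$, and moreover $2n_2=n_1+n_3$ and $C=\frac{B^2}{4A}$; (4) $g(x)=\left(Ax(x-c^2)+D\right)\circ l$ and $h(x)=l^{-1}\circ\left(x^{2n_3}+cx^{n_3}\right)$ for some linear polynomial $l\in K[x]$ and some non-zero $c\in K$, and moreover $n_1=4n_3$ and $n_2=3n_3$.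
   Context: A linear polynomial is a polynomial of degree exactly $1$; $l^{-1}$ denotes its inverse with respect to composition, and $p\circ q$ denotes the composition $p(q(x))$. *)

theory Defs
  imports "HOL-Computational_Algebra.Polynomial"
begin

definition linear_poly :: "'a::field poly \<Rightarrow> bool" where
  "linear_poly l \<longleftrightarrow> degree l = 1"

text \<open>
  The inverse with respect to composition is meaningful for linear polynomials only; see
  \<open>comp_inverse_unique_ex\<close> for existence and uniqueness.
\<close>

definition comp_inverse :: "'a::field poly \<Rightarrow> 'a poly" where
  "comp_inverse l = (THE m. l \<circ>\<^sub>p m = [:0, 1:] \<and> m \<circ>\<^sub>p l = [:0, 1:])"

lemma comp_inverse_unique_ex:
  fixes l :: "'a::field poly"
  assumes "linear_poly l"
  shows "\<exists>!m. l \<circ>\<^sub>p m = [:0, 1:] \<and> m \<circ>\<^sub>p l = [:0, 1:]"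
proof -
  obtain a b where l: "l = [:a, b:]" and b: "b \<noteq> 0"
    using assms unfolding linear_poly_def
    by (metis degree_eq_zeroE degree_pCons_eq_if pCons_0_0 pCons_cases zero_neq_one
        One_nat_def nat.inject)
  have 1: "l \<circ>\<^sub>p [:- a / b, 1 / b:] = [:0, 1:]" "[:- a / b, 1 / b:] \<circ>\<^sub>p l = [:0, 1:]"
    using b by (simp_all add: l pcompose_pCons)
  show ?thesis
  proof (rule ex1I[of _ "[:- a / b, 1 / b:]"])
    fix m assume m: "l \<circ>\<^sub>p m = [:0, 1:] \<and> m \<circ>\<^sub>p l = [:0, 1:]"
    have "m = (m \<circ>\<^sub>p l) \<circ>\<^sub>p [:- a / b, 1 / b:]"
      by (metis 1(1) pcompose_assoc pcompose_idR)
    also have "\<dots> = [:- a / b, 1 / b:]"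
      using m by (simp add: pcompose_pCons)
    finally show "m = [:- a / b, 1 / b:]" .
  qed (use 1 in auto)
qed

lemma comp_inverse_right: "linear_poly l \<Longrightarrow> l \<circ>\<^sub>p comp_inverse l = [:0, 1:]"
  and comp_inverse_left: "linear_poly l \<Longrightarrow> comp_inverse l \<circ>\<^sub>p l = [:0, 1:]"
  using theI'[OF comp_inverse_unique_ex[of l]] unfolding comp_inverse_def by auto

end

theory Submission
  imports Defs
begin

text \<open>
  After composing with a linear polynomial, \<open>f - D = G \<circ> h\<close> with \<open>h\<close> monic, \<open>h(0) = 0\<close>,
  \<open>deg G = t \<ge> 2\<close>, \<open>deg h = k\<close>, and \<open>h\<close> not a monomial. Removing the second highest coefficient
  of \<open>G\<close> by a shift of \<open>h\<close> gives \<open>F := f - D = A H\<^sup>t + r\<close> with \<open>deg r \<le> (t - 2) k\<close>, so that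
  \<open>F' H - t F H'\<close> has small degree. The vanishing of its high coefficients says that \<open>H\<close> follows the
  expansion of the \<open>t\<close>-th root of \<open>A x\<^bsup>n1\<^esup> + B x\<^bsup>n2\<^esup>\<close> as long as \<open>C x\<^bsup>n3\<^esup>\<close> does not
  interfere. With \<open>p = n1 - n2\<close>, this root has non-zero coefficients at all exponents \<open>k - i p\<close>,
  including negative ones, whereas \<open>H\<close> is a polynomial. Hence \<open>n1 - n3 \<le> k + p\<close>. Unless \<open>G\<close> is a
  monomial, the order of vanishing at 0 gives the opposite inequality \<open>n1 - n3 \<ge> k + (t - 1) p\<close>,
  which forces \<open>t = 2\<close> and the quartic case. If \<open>G = A x\<^sup>t\<close>, then the two highest and the two lowest
  terms of \<open>A h\<^sup>t\<close> must overlap, which forces \<open>t = 2\<close> and a binomial \<open>h\<close>.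
\<close>

section \<open>Coefficient relations from \<open>x (F' H - t F H')\<close>\<close>

text \<open>
  The contribution of the monomial \<open>c x\<^sup>n\<close> of \<open>F\<close> to the coefficient of \<open>x\<^sup>m\<close> in
  \<open>x (F' H - t F H')\<close>.
\<close>

definition euler_term :: "nat \<Rightarrow> 'a::comm_ring_1 poly \<Rightarrow> nat \<Rightarrow> 'a \<Rightarrow> nat \<Rightarrow> 'a" where
  "euler_term t H m c n =
    (if m < n then 0 else c * (of_nat n - of_nat t * of_nat (m - n)) * coeff H (m - n))"

lemma euler_term_eq_coeff:
  "euler_term t H m c n =
    coeff (pCons 0 (pderiv (monom c n)) * H - smult (of_nat t) (monom c n * pCons 0 (pderiv H))) m"
proof -
  have 1: "pCons 0 (pderiv (monom c n)) = monom (of_nat n * c) n"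
    by (rule poly_eqI) (auto simp: coeff_pCons coeff_pderiv split: nat.splits)
  have 2: "coeff (pCons 0 (pderiv H)) i = of_nat i * coeff H i" for i
    by (cases i) (auto simp: coeff_pderiv)
  show ?thesis
    unfolding 1 coeff_diff coeff_smult coeff_monom_mult 2 euler_term_def
    by (simp add: algebra_simps)
qed

text \<open>The operator \<open>D\<close> is linear in its argument and kills \<open>H ^ t\<close>,
  being \<open>x\<close> times \<open>H ^ (t + 1)\<close> times the derivative of
  \<open>F / H ^ t\<close>. Since \<open>x d/dx\<close> does not raise degrees, \<open>D r\<close>
  has degree at most \<open>degree r + degree H\<close>, so it is invisible at
  \<open>m\<close>.\<close>

lemma euler_terms_sum_zero:
  fixes H r :: "'a::idom poly"
  assumes F: "monom A n1 + monom B n2 + monom C n3 = smult a (H ^ t) + r"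
    and m: "r = 0 \<or> degree r + degree H < m"
  shows "euler_term t H m A n1 + euler_term t H m B n2 + euler_term t H m C n3 = 0"
proof -
  define D where "D = (\<lambda>F. pCons 0 (pderiv F) * H - smult (of_nat t) (F * pCons 0 (pderiv H)))"
  define X :: "'a poly" where "X = [:0, 1:]"
  have pCons_0_eq: "pCons 0 P = X * P" for P
    by (simp add: X_def)
  have D_add: "D (P + Q) = D P + D Q" for P Q
    unfolding D_def pCons_0_eq by (simp add: pderiv_add smult_add_right algebra_simps)
  have "D (smult a (H ^ t)) = 0"
  proof (cases t)
    case (Suc s)
    show ?thesis
      unfolding D_def pCons_0_eq Suc pderiv_smult pderiv_power_Suc
      by (simp add: algebra_simps)
  qed (simp add: D_def pderiv_smult)
  moreover have "coeff (D r) m = 0"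
  proof (cases "r = 0")
    case False
    have deg: "degree (pCons 0 (pderiv P)) \<le> degree P" for P :: "'a poly"
      by (rule degree_le) (auto simp: coeff_pCons coeff_pderiv coeff_eq_0 split: nat.splits)
    have "degree (pCons 0 (pderiv r) * H) < m" "degree (smult (of_nat t) (r * pCons 0 (pderiv H))) < m"
      using False m deg[of r] deg[of H] degree_mult_le[of "pCons 0 (pderiv r)" H]
        degree_mult_le[of r "pCons 0 (pderiv H)"]
        degree_smult_le[of "of_nat t" "r * pCons 0 (pderiv H)"] by linarith+
    then show ?thesis
      unfolding D_def coeff_diff by (simp only: coeff_eq_0 diff_self)
  qed (simp add: D_def)
  ultimately have "coeff (D (monom A n1 + monom B n2 + monom C n3)) m = 0"
    unfolding F D_add by simp
  then show ?thesis
    unfolding D_add unfolding D_def coeff_add euler_term_eq_coeff .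
qed

section \<open>Composition and order of vanishing at 0\<close>

lemma pcompose_power: "(p ^ n) \<circ>\<^sub>p q = (p \<circ>\<^sub>p q) ^ n"
  for p q :: "'a::comm_semiring_1 poly"
  by (induction n) (simp_all add: pcompose_1 pcompose_mult)

lemma pcompose_monom: "monom c n \<circ>\<^sub>p q = smult c (q ^ n)"
  for q :: "'a::comm_semiring_1 poly"
  by (simp add: monom_altdef pcompose_smult pcompose_power pcompose_pCons)

lemma order_0_power: "p \<noteq> 0 \<Longrightarrow> order 0 (p ^ n) = n * order 0 p"
  for p :: "'a::idom poly"
  by (induction n) (auto simp: order_mult)

text \<open>Write \<open>G\<close> as a power of \<open>x\<close> times \<open>Q\<close> with
  \<open>Q(0)\<close> non-zero. As \<open>h(0) = 0\<close>, the factor \<open>Q(h)\<close> does not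
  vanish at 0, so only the power of \<open>h\<close> contributes.\<close>

lemma order_0_pcompose:
  fixes G h :: "'a::idom poly"
  assumes "G \<noteq> 0" "h \<noteq> 0" "coeff h 0 = 0"
  shows "order 0 (G \<circ>\<^sub>p h) = order 0 G * order 0 h"
proof -
  obtain Q where G: "G = monom 1 (order 0 G) * Q" and "\<not> [:0, 1:] dvd Q"
    using order_decomp[OF assms(1), of 0] by (auto simp: monom_altdef)
  then have "poly Q 0 \<noteq> 0"
    using poly_eq_0_iff_dvd[of Q 0] by simp
  have Q: "Q \<circ>\<^sub>p h \<noteq> 0" "order 0 (Q \<circ>\<^sub>p h) = 0"
  proof -
    have "poly (Q \<circ>\<^sub>p h) 0 \<noteq> 0"
      using \<open>poly Q 0 \<noteq> 0\<close> assms(3) by (simp add: poly_pcompose poly_0_coeff_0)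
    then show "Q \<circ>\<^sub>p h \<noteq> 0" "order 0 (Q \<circ>\<^sub>p h) = 0"
      by (auto simp: order_0I)
  qed
  have "G \<circ>\<^sub>p h = h ^ order 0 G * (Q \<circ>\<^sub>p h)"
    by (subst G) (simp add: pcompose_mult pcompose_monom)
  then show ?thesis
    using Q assms(2) by (simp add: order_mult order_0_power)
qed

lemma order_0_le: "coeff p i \<noteq> 0 \<Longrightarrow> order 0 p \<le> i"
  for p :: "'a::idom poly"
  using monom_1_dvd_iff[of p "order 0 p"] monom_1_dvd_iff'[of "order 0 p" p]
  by (metis coeff_0 leI order_refl)

lemma coeff_less_order_0: "i < order 0 p \<Longrightarrow> coeff p i = 0"
  for p :: "'a::idom poly"
  using order_0_le by (metis leD)

lemma coeff_order_0: "p \<noteq> 0 \<Longrightarrow> coeff p (order 0 p) \<noteq> 0"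
  for p :: "'a::idom poly"
proof
  assume "p \<noteq> 0" "coeff p (order 0 p) = 0"
  then have "monom 1 (Suc (order 0 p)) dvd p"
    by (subst monom_1_dvd_iff') (auto simp: less_Suc_eq coeff_less_order_0)
  then show False
    using \<open>p \<noteq> 0\<close> by (simp add: monom_1_dvd_iff)
qed

lemma order_0_trinomial:
  fixes A B C :: "'a::idom"
  assumes "C \<noteq> 0" "n3 < n2" "n2 < n1"
  shows "order 0 (monom A n1 + monom B n2 + monom C n3) = n3" (is "order 0 ?F = _")
proof (rule antisym)
  have c: "coeff ?F n3 = C" using assms by simp
  then show "order 0 ?F \<le> n3" using order_0_le assms(1) by metis
  have "?F \<noteq> 0" using c assms(1) by (metis coeff_0)
  moreover have "monom 1 n3 dvd ?F"
    using assms by (subst monom_1_dvd_iff') auto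
  ultimately show "n3 \<le> order 0 ?F" by (simp add: monom_1_dvd_iff)
qed

section \<open>The second highest exponent of the inner polynomial\<close>

text \<open>The leading terms cancel because \<open>n1 = t * degree H\<close>, which leaves
  \<open>n1 + j\<close> and \<open>n2 + degree H\<close> as the highest exponents that can occur. If
  they differed, the larger would receive a single contribution, with factor
  \<open>n1 - t * j\<close> or \<open>n2 - t * degree H\<close>, and neither is zero in
  characteristic 0.\<close>

lemma euler_gap:
  fixes H :: "'a::field_char_0 poly"
  assumes "A \<noteq> 0" "B \<noteq> 0" "n3 < n2" "n2 < n1" and n1: "n1 = t * degree H" and t: "0 < t"
    and E: "\<And>m. (t - 1) * degree H < m \<Longrightarrow>
      euler_term t H m A n1 + euler_term t H m B n2 + euler_term t H m C n3 = 0"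
    and j: "0 < j" "j < degree H" "coeff H j \<noteq> 0" "\<And>i. j < i \<Longrightarrow> i < degree H \<Longrightarrow> coeff H i = 0"
  shows "n1 + j = n2 + degree H"
proof (rule ccontr)
  assume neq: "n1 + j \<noteq> n2 + degree H"
  have low: "(t - 1) * degree H \<le> n1"
    unfolding n1 by (intro mult_right_mono) auto
  show False
  proof (cases "n1 + j < n2 + degree H")
    case False
    have "euler_term t H (n1 + j) B n2 = 0" "euler_term t H (n1 + j) C n3 = 0"
      using False neq assms(3,4) by (auto simp: euler_term_def intro!: coeff_eq_0)
    then have "euler_term t H (n1 + j) A n1 = 0"
      using E[of "n1 + j"] low j(1) by simp
    then have "(of_nat n1 :: 'a) = of_nat (t * j)"
      using \<open>A \<noteq> 0\<close> j(3) by (simp add: euler_term_def)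
    then have "t * degree H = t * j"
      unfolding of_nat_eq_iff n1 .
    then show False using t j(2) by simp
  next
    case True
    have "coeff H (n2 + degree H - n1) = 0" if "n1 \<le> n2 + degree H"
      using True assms(3,4) by (intro j(4)) auto
    then have "euler_term t H (n2 + degree H) A n1 = 0"
      by (auto simp: euler_term_def)
    moreover have "euler_term t H (n2 + degree H) C n3 = 0"
      using assms(3) by (auto simp: euler_term_def intro!: coeff_eq_0)
    ultimately have "euler_term t H (n2 + degree H) B n2 = 0"
      using E[of "n2 + degree H"] low True by simp
    moreover have "coeff H (degree H) \<noteq> 0" using j(2) by auto
    ultimately have "(of_nat n2 :: 'a) = of_nat (t * degree H)"
      using \<open>B \<noteq> 0\<close> by (simp add: euler_term_def)
    then show False
      unfolding of_nat_eq_iff using n1 assms(4) by simp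
  qed
qed

section \<open>Outer polynomial a monomial\<close>

lemma binomial_poly_eqI:
  fixes h :: "'a::comm_ring_1 poly"
  assumes "lead_coeff h = 1" "b < degree h" "\<And>i. b < i \<Longrightarrow> i < degree h \<Longrightarrow> coeff h i = 0"
    and "\<And>i. i < b \<Longrightarrow> coeff h i = 0"
  shows "h = monom 1 (degree h) + monom (coeff h b) b"
proof (rule poly_eqI)
  fix i
  show "coeff h i = coeff (monom 1 (degree h) + monom (coeff h b) b) i"
    using assms coeff_eq_0[of h i] linorder_less_linear[of i b] linorder_less_linear[of i "degree h"]
    by auto
qed

lemma binomial_square:
  fixes \<beta> :: "'a::comm_ring_1"
  shows "(monom 1 k + monom \<beta> j)\<^sup>2 = monom 1 (2 * k) + monom (2 * \<beta>) (k + j) + monom (\<beta>\<^sup>2) (2 * j)"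
  unfolding power2_eq_square distrib_left distrib_right mult_monom mult_2 add_monom[symmetric]
  by (simp add: ac_simps)

text \<open>With no remainder the relations hold at every exponent, so they can be used from the
  bottom as well as from the top. Both ends together leave room only for \<open>t = 2\<close> and a
  binomial \<open>h\<close>; comparing coefficients then gives \<open>B\<close> and
  \<open>C\<close>.\<close>

lemma trinomial_pure_power:
  fixes A B C :: "'a::field_char_0"
  assumes ABC: "A \<noteq> 0" "B \<noteq> 0" "C \<noteq> 0" and n: "n3 < n2" "n2 < n1"
    and F: "monom A n1 + monom B n2 + monom C n3 = smult A (h ^ t)"
    and h: "lead_coeff h = 1" and n1: "n1 = t * degree h" and n3: "n3 = t * order 0 h"
    and t: "2 \<le> t"
    and j: "0 < j" "j < degree h" "coeff h j \<noteq> 0" "\<And>i. j < i \<Longrightarrow> i < degree h \<Longrightarrow> coeff h i = 0"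
  shows "t = 2 \<and> even n1 \<and> even n3 \<and> 2 * n2 = n1 + n3 \<and> C = B\<^sup>2 / (4 * A) \<and>
    h = monom 1 (n1 div 2) + monom (B / (2 * A)) (n3 div 2)"
proof -
  define k b where "k = degree h" and "b = order 0 h"
  have h_nz: "h \<noteq> 0" using j by auto
  have E: "euler_term t h m A n1 + euler_term t h m B n2 + euler_term t h m C n3 = 0" for m
    using F by (intro euler_terms_sum_zero[where r = 0]) auto
  have gap: "n1 + j = n2 + k"
    unfolding k_def using ABC n n1 t E j
    by (intro euler_gap[where A = A and B = B and C = C and t = t]) auto
  have bj: "b \<le> j"
    unfolding b_def using j(3) by (rule order_0_le)
  have hb: "coeff h b \<noteq> 0"
    unfolding b_def using h_nz by (rule coeff_order_0)
  \<comment> \<open>At this exponent the \<open>A\<close> term would need a coefficient of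
    \<open>h\<close> below its order \<open>b\<close>. Hence the \<open>B\<close> and
    \<open>C\<close> terms must cancel each other.\<close>
  have "euler_term t h (n2 + b) A n1 = 0"
    using n by (auto simp: euler_term_def b_def intro!: coeff_less_order_0)
  then have *: "euler_term t h (n2 + b) B n2 + euler_term t h (n2 + b) C n3 = 0"
    using E[of "n2 + b"] by simp
  have "euler_term t h (n2 + b) B n2 \<noteq> 0"
  proof
    assume "euler_term t h (n2 + b) B n2 = 0"
    then have "(of_nat n2 :: 'a) = of_nat (t * b)"
      using ABC hb by (simp add: euler_term_def)
    then show False
      unfolding of_nat_eq_iff using n n3 b_def by simp
  qed
  then have "euler_term t h (n2 + b) C n3 \<noteq> 0" using * by auto
  then have "coeff h (n2 + b - n3) \<noteq> 0" by (auto simp: euler_term_def split: if_splits)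
  then have top: "n2 + b - n3 \<le> k" unfolding k_def by (rule le_degree)
  \<comment> \<open>The left side is \<open>n1 - n3\<close>. It splits into
    \<open>n1 - n2 = k - j\<close> and \<open>n2 - n3\<close>, which \<open>top\<close> bounds by
    \<open>k - b\<close>.\<close>
  have le: "t * (k - b) \<le> (k - j) + (k - b)"
    using gap top n1 n3 n j(2) bj unfolding k_def[symmetric] b_def[symmetric]
    by (simp add: diff_mult_distrib2)
  also have "\<dots> \<le> 2 * (k - b)" using bj by simp
  finally have t2: "t = 2"
    using t j(2) bj unfolding k_def[symmetric] by simp
  have jb: "j = b"
    using le bj j(2) unfolding t2 k_def[symmetric] by simp
  define \<beta> where "\<beta> = coeff h j"
  have h_eq: "h = monom 1 k + monom \<beta> j"
    unfolding k_def \<beta>_def using h j jb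
    by (intro binomial_poly_eqI) (auto simp: b_def coeff_less_order_0)
  have n_eq: "n1 = 2 * k" "n3 = 2 * j" "n2 = k + j"
    using n1 n3 gap unfolding t2 jb k_def[symmetric] b_def[symmetric] by auto
  have "smult A (h ^ t) = monom A n1 + monom (2 * A * \<beta>) n2 + monom (A * \<beta>\<^sup>2) n3"
    unfolding n_eq t2 by (subst h_eq) (simp add: binomial_square smult_add_right smult_monom mult_ac)
  then have F': "monom A n1 + monom B n2 + monom C n3 =
      monom A n1 + monom (2 * A * \<beta>) n2 + monom (A * \<beta>\<^sup>2) n3"
    using F by simp
  have BC: "B = 2 * A * \<beta>" "C = A * \<beta>\<^sup>2"
    using arg_cong[OF F', of "\<lambda>p. coeff p n2"] arg_cong[OF F', of "\<lambda>p. coeff p n3"] n by auto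
  have "\<beta> = B / (2 * A)" using BC ABC(1) by simp
  moreover have "C = B\<^sup>2 / (4 * A)" using BC ABC(1) by (simp add: power2_eq_square)
  moreover have "n1 div 2 = k" "n3 div 2 = j" using n_eq by auto
  moreover have "even n1" "even n3" "2 * n2 = n1 + n3" using n_eq by auto
  ultimately show ?thesis
    using t2 h_eq by simp
qed

section \<open>The expansion of the root and where it must stop\<close>

text \<open>The relation at \<open>n1 + degree H - (i + 1) p\<close> is the recursion of the
  binomial series: it ties the coefficient at \<open>degree H - (i + 1) p\<close> to the one at
  \<open>degree H - i p\<close>. The factor \<open>n2 - t (degree H - i p) = (t i - 1) p\<close> is
  non-zero as \<open>t \<ge> 2\<close>, and \<open>q\<close> keeps the \<open>C\<close> term
  out.\<close>

lemma exponent_chain_nonzero: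
  fixes H :: "'a::field_char_0 poly"
  assumes "A \<noteq> 0" "B \<noteq> 0" "n3 < n2" and n1: "n1 = t * degree H" and t: "2 \<le> t"
    and p: "0 < p" "n1 = n2 + p" and q: "n3 + degree H < n1"
    and E: "\<And>m. (t - 1) * degree H < m \<Longrightarrow>
      euler_term t H m A n1 + euler_term t H m B n2 + euler_term t H m C n3 = 0"
    and "H \<noteq> 0" "i * p \<le> degree H"
  shows "coeff H (degree H - i * p) \<noteq> 0"
  using \<open>i * p \<le> degree H\<close>
proof (induction i)
  case 0
  then show ?case using \<open>H \<noteq> 0\<close> by simp
next
  case (Suc i)
  define k e where "k = degree H" and "e = degree H - Suc i * p"
  have k: "k = e + p + i * p" using Suc.prems by (simp add: k_def e_def)
  have "t * k = (t - 1) * k + k" using t by (cases t) auto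
  moreover have "0 < k" using k p(1) by simp
  ultimately have "(t - 1) * k < n1 + e" using n1 unfolding k_def[symmetric] by linarith
  then have *: "euler_term t H (n1 + e) A n1 + euler_term t H (n1 + e) B n2 +
      euler_term t H (n1 + e) C n3 = 0"
    using E unfolding k_def by blast
  have idx: "n1 + e - n2 = e + p" using p(2) by simp
  have "euler_term t H (n1 + e) C n3 = 0"
    using q by (auto simp: euler_term_def intro!: coeff_eq_0)
  moreover have "euler_term t H (n1 + e) B n2 \<noteq> 0"
  proof
    assume "euler_term t H (n1 + e) B n2 = 0"
    moreover have "coeff H (e + p) \<noteq> 0"
      using Suc k unfolding k_def by simp
    ultimately have "(of_nat n2 :: 'a) = of_nat (t * (e + p))"
      using \<open>B \<noteq> 0\<close> p(2) idx by (auto simp: euler_term_def add.commute split: if_splits)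
    then have "n2 = t * (e + p)" unfolding of_nat_eq_iff .
    then have "t * (e + p) + p = t * (e + p) + (t * i) * p"
      using n1 p(2) k unfolding k_def[symmetric] by (simp add: algebra_simps)
    then have "t * i = 1" using p(1) by simp
    then show False using t by simp
  qed
  ultimately have "euler_term t H (n1 + e) A n1 \<noteq> 0" using * by auto
  then show ?case unfolding e_def[symmetric] by (auto simp: euler_term_def)
qed

text \<open>The chain is followed one step beyond its last non-negative exponent. There only the
  \<open>C\<close> term can balance the \<open>B\<close> term, so \<open>n1 - n3 \<le> k + p\<close>
  where \<open>k = degree H\<close>. Assumption \<open>q\<close> says
  \<open>n1 - n3 \<ge> k + (t - 1) p\<close>, so equality holds throughout.\<close>

lemma euler_gaps_tight:
  fixes H :: "'a::field_char_0 poly"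
  assumes ABC: "A \<noteq> 0" "B \<noteq> 0" and "n3 < n2" and n1: "n1 = t * degree H" and t: "2 \<le> t"
    and p: "0 < p" "n1 = n2 + p" "p < degree H" and q: "n3 \<le> (t - 1) * (degree H - p)"
    and E: "\<And>m. (t - 1) * degree H < m \<Longrightarrow>
      euler_term t H m A n1 + euler_term t H m B n2 + euler_term t H m C n3 = 0"
  shows "t = 2 \<and> n3 = degree H - p \<and> p dvd degree H"
proof -
  define k i where "k = degree H" and "i = k div p"
  have H: "H \<noteq> 0" using p by auto
  have ip: "i * p \<le> k" "k < i * p + p"
    unfolding i_def using p(1) by (simp_all add: dividend_less_div_times add.commute)
  have tk: "t * k = (t - 1) * k + k" using t by (cases t) auto
  have q': "n3 + (t - 1) * p \<le> (t - 1) * k"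
    using q p(3) unfolding k_def[symmetric]
    by (metis add.commute add_le_cancel_left diff_mult_distrib2 le_add_diff_inverse2 less_imp_le
        mult_le_mono2)
  have p1: "p \<le> (t - 1) * p" using t by (cases "t - 1") auto
  have gap: "n3 + degree H < n1"
    using q' p1 p(1) tk n1 unfolding k_def by linarith
  have nz: "coeff H (k - i * p) \<noteq> 0"
    unfolding k_def
    by (rule exponent_chain_nonzero[OF ABC \<open>n3 < n2\<close> n1 t p(1,2) gap _ H ip(1)[unfolded k_def]])
       (rule E)
  \<comment> \<open>This is the next relation of the chain. The exponent
    \<open>k - (i + 1) p\<close> is negative, so \<open>m < n1\<close> and the \<open>A\<close> term
    is absent; \<open>p < k\<close> keeps \<open>m\<close> in the range of \<open>E\<close>.\<close>
  define m where "m = n1 + k - (i * p + p)"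
  have m: "m + i * p + p = n1 + k" "(t - 1) * k < m" "m < n1"
    using n1 tk ip p(3) unfolding m_def k_def[symmetric] by linarith+
  have idx: "m - n2 = k - i * p" "n2 \<le> m"
    using m p ip by auto
  have "euler_term t H m A n1 + euler_term t H m B n2 + euler_term t H m C n3 = 0"
    using E m(2) unfolding k_def by blast
  moreover have "euler_term t H m A n1 = 0"
    using m(3) by (simp add: euler_term_def)
  moreover have "euler_term t H m B n2 \<noteq> 0"
  proof
    assume "euler_term t H m B n2 = 0"
    then have "(of_nat n2 :: 'a) = of_nat (t * (k - i * p))"
      using ABC nz idx by (simp add: euler_term_def split: if_splits)
    then have "n2 = t * (k - i * p)" unfolding of_nat_eq_iff .
    then have "t * k = t * (k - i * p) + p" using n1 p unfolding k_def by simp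
    moreover have "t * k = t * (k - i * p) + (t * i) * p"
      using ip by (metis add.commute le_add_diff_inverse mult.assoc distrib_left)
    ultimately have "t * i = 1" using p(1) by simp
    then show False using t by simp
  qed
  ultimately have "coeff H (m - n3) \<noteq> 0" by (auto simp: euler_term_def split: if_splits)
  then have "m - n3 \<le> k" unfolding k_def by (rule le_degree)
  then have "n1 \<le> n3 + i * p + p" using m by linarith
  then have fin: "(t - 1) * p \<le> p" "n1 = n3 + k + p" "k = i * p"
    using n1 tk q' p1 ip unfolding k_def[symmetric] by linarith+
  then have "t - 1 \<le> 1" using p(1) by simp
  then have "t = 2" using t by simp
  moreover have "p dvd k" using fin(3) by simp
  moreover have "n3 = k - p" using fin(2) n1 \<open>t = 2\<close> unfolding k_def[symmetric] by simp
  ultimately show ?thesis unfolding k_def by blast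
qed

section \<open>Outer polynomial not a monomial\<close>

text \<open>The tight bounds give \<open>t = 2\<close> and \<open>n3 = j\<close>. Then
  \<open>G\<close> has a simple zero at 0, so \<open>h\<close> has order \<open>j\<close> and is a
  binomial. The chain fixes \<open>degree h = 2 * j\<close>, and a missing term of the trinomial
  fixes \<open>G\<close>.\<close>

lemma trinomial_mixed:
  fixes A B C :: "'a::field_char_0"
  assumes ABC: "A \<noteq> 0" "B \<noteq> 0" "C \<noteq> 0" and n: "n3 < n2" "n2 < n1" "0 < n3"
    and F: "monom A n1 + monom B n2 + monom C n3 = G \<circ>\<^sub>p h"
    and h: "lead_coeff h = 1" "coeff h 0 = 0"
    and n1: "n1 = degree G * degree h" and n3: "n3 = order 0 G * order 0 h"
    and t: "2 \<le> degree G" and A: "lead_coeff G = A" and ord: "order 0 G < degree G"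
    and j: "0 < j" "j < degree h" "coeff h j \<noteq> 0" "\<And>i. j < i \<Longrightarrow> i < degree h \<Longrightarrow> coeff h i = 0"
  shows "n1 = 4 * n3 \<and> n2 = 3 * n3 \<and>
    G = smult A ([:0, 1:] * ([:0, 1:] - [:(coeff h j)\<^sup>2:])) \<and>
    h = monom 1 (2 * n3) + monom (coeff h j) n3"
proof -
  define k t where "k = degree h" and "t = degree G"
  define c where "c = coeff G (t - 1) / (of_nat t * A)"
  \<comment> \<open>Adding this constant to \<open>h\<close> amounts to removing the second highest coefficient of \<open>G\<close>.\<close>
  define H where "H = h + [:c:]"
  define s where "s = G - smult A ([:c, 1:] ^ t)"
  have t2: "2 \<le> t" using t t_def by simp
  have deg_s: "degree s \<le> t - 2"
  proof (rule degree_le, intro allI impI)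
    fix i assume "t - 2 < i"
    then consider "i = t - 1" | "i = t" | "t < i" by linarith
    then show "coeff s i = 0"
    proof cases
      case 1
      have "t choose (t - 1) = t" "t - (t - 1) = 1" using t2 by (cases t; simp)+
      then have "coeff ([:c, 1:] ^ t) i = of_nat t * c"
        using 1 by (subst coeff_linear_poly_power) auto
      then show ?thesis using 1 t2 ABC by (simp add: s_def c_def)
    next
      case 2
      then show ?thesis using A by (simp add: s_def coeff_linear_power t_def)
    next
      case 3
      then show ?thesis
        by (simp add: s_def t_def coeff_eq_0 degree_linear_power)
    qed
  qed
  have "[:c, 1:] \<circ>\<^sub>p h = H"
    by (simp add: pcompose_pCons H_def)
  then have dec: "monom A n1 + monom B n2 + monom C n3 = smult A (H ^ t) + s \<circ>\<^sub>p h"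
    unfolding F s_def pcompose_diff pcompose_smult pcompose_power by simp
  have k0: "0 < k" "j < k" using j k_def by auto
  have degH: "degree H = k"
    using k0 unfolding H_def k_def by (simp add: degree_add_eq_left)
  have coeffH: "coeff H i = coeff h i" if "0 < i" for i
    using that by (cases i) (auto simp: H_def)
  have tk: "t * k = (t - 1) * k + k" "(t - 1) * k = (t - 2) * k + k"
    using t2 by (auto simp: algebra_simps simp flip: add_mult_distrib)
  \<comment> \<open>The threshold is \<open>(t - 2) * k + k\<close>, where
    \<open>(t - 2) * k\<close> bounds the degree of \<open>s\<close> composed with
    \<open>h\<close>.\<close>
  have E: "euler_term t H m A n1 + euler_term t H m B n2 + euler_term t H m C n3 = 0"
    if "(t - 1) * degree H < m" for m
  proof (rule euler_terms_sum_zero[OF dec], rule disjI2)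
    have "degree (s \<circ>\<^sub>p h) \<le> (t - 2) * k"
      using degree_pcompose_le[of s h] deg_s unfolding k_def by (meson mult_le_mono1 order_trans)
    then show "degree (s \<circ>\<^sub>p h) + degree H < m"
      using that tk unfolding degH by linarith
  qed
  have n1': "n1 = t * degree H" using n1 unfolding degH k_def t_def .
  have gap: "n1 + j = n2 + k"
    unfolding degH[symmetric]
    using ABC n n1' t2 E j k_def degH coeffH
    by (intro euler_gap[where A = A and B = B and C = C and t = t]) auto
  have bj: "order 0 h \<le> j" using j(3) by (rule order_0_le)
  have tight: "t = 2 \<and> n3 = degree H - (k - j) \<and> k - j dvd degree H"
  proof (rule euler_gaps_tight[where A = A and B = B and C = C and ?n1.0 = n1 and ?n2.0 = n2])
    \<comment> \<open>Here it matters that \<open>G\<close> is not a monomial: its order is at most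
      \<open>t - 1\<close>, and that of \<open>h\<close> is at most \<open>j\<close>.\<close>
    have "n3 \<le> (t - 1) * j"
      unfolding n3 using ord bj t_def by (intro mult_le_mono) auto
    then show "n3 \<le> (t - 1) * (degree H - (k - j))" using k0 unfolding degH by simp
  qed (use ABC n n1' t2 E gap k0 j(1) degH in auto)
  then have t_eq: "t = 2" and n3j: "n3 = j" and dvd: "k - j dvd k"
    using k0 unfolding degH by auto
  have "order 0 G = 1"
    using ord n3 n(3) t_eq unfolding t_def by (cases "order 0 G") auto
  then have low: "coeff h i = 0" if "i < j" for i
    using that n3 n3j by (intro coeff_less_order_0) simp
  have h_eq: "h = monom 1 k + monom (coeff h j) j"
    unfolding k_def using h j low by (intro binomial_poly_eqI) auto
  \<comment> \<open>Divisibility makes room for a third chain exponent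
    \<open>k - 2 * (k - j)\<close>, which is below \<open>j\<close>. As \<open>h\<close> has no term
    there, the non-zero coefficient of \<open>H\<close> must come from the constant
    \<open>c\<close>, so the exponent is 0.\<close>
  have k_eq: "k = 2 * j"
  proof -
    obtain i where i: "k = (k - j) * i" using dvd by blast
    then have "2 \<le> i" using k0 j(1) by (cases i rule: nat.exhaust; cases "i - 1") auto
    then have le: "2 * (k - j) \<le> k" using mult_le_mono2[of 2 i "k - j"] i by linarith
    have "n3 + degree H < n1"
      using n3j k0 n1' unfolding degH t_eq by simp
    then have "coeff H (degree H - 2 * (k - j)) \<noteq> 0"
      using ABC n n1' t2 E gap k0 le degH
      by (intro exponent_chain_nonzero[where A = A and B = B and C = C and t = t
            and ?n1.0 = n1 and ?n2.0 = n2 and ?n3.0 = n3]) auto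
    then have "k - 2 * (k - j) = 0"
      using low[of "k - 2 * (k - j)"] coeffH[of "k - 2 * (k - j)"] k0 unfolding degH by fastforce
    then show ?thesis using le k0 by simp
  qed
  define \<beta> where "\<beta> = coeff h j"
  have n_eq: "n1 = 4 * j" "n2 = 3 * j" using n1 gap k_eq t_eq unfolding k_def t_def by auto
  have "coeff G 0 = 0"
    using \<open>order 0 G = 1\<close> by (intro coeff_less_order_0) simp
  then have G: "G = [:0, coeff G 1, A:]"
    using A t_eq unfolding t_def
    by (intro poly_eqI) (auto simp: coeff_pCons numeral_2_eq_2 coeff_eq_0 split: nat.splits)
  have "G \<circ>\<^sub>p h = smult (coeff G 1) h + smult A (h\<^sup>2)"
    by (subst G) (simp add: pcompose_pCons power2_eq_square algebra_simps smult_add_right)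
  also have "\<dots> = smult (coeff G 1) (monom 1 k + monom \<beta> j) +
      smult A (monom 1 (2 * k) + monom (2 * \<beta>) (k + j) + monom (\<beta>\<^sup>2) (2 * j))"
    unfolding binomial_square[symmetric] \<beta>_def h_eq[symmetric] ..
  \<comment> \<open>Since \<open>k = 2 * j\<close> lies strictly between \<open>n3 = j\<close> and
    \<open>n2 = 3 * j\<close>, the left side is 0.\<close>
  finally have "coeff (monom A n1 + monom B n2 + monom C n3) k = coeff \<dots> k"
    unfolding F by simp
  then have "coeff G 1 + A * \<beta>\<^sup>2 = 0"
    using j(1) unfolding k_eq n_eq n3j by simp
  then have "coeff G 1 = - (A * \<beta>\<^sup>2)" by (simp add: eq_neg_iff_add_eq_0)
  then have "G = smult A ([:0, 1:] * ([:0, 1:] - [:\<beta>\<^sup>2:]))"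
    by (subst G) simp
  then show ?thesis
    using n_eq n3j h_eq k_eq unfolding \<beta>_def by simp
qed

lemma trinomial_decomposition_normalized:
  fixes A B C :: "'a::field_char_0"
  assumes ABC: "A \<noteq> 0" "B \<noteq> 0" "C \<noteq> 0" and n: "n3 < n2" "n2 < n1" "0 < n3"
    and F: "monom A n1 + monom B n2 + monom C n3 = G \<circ>\<^sub>p h"
    and h: "lead_coeff h = 1" "coeff h 0 = 0" "h \<noteq> monom 1 (degree h)"
    and t: "2 \<le> degree G"
  shows "(even n1 \<and> even n3 \<and> 2 * n2 = n1 + n3 \<and> C = B\<^sup>2 / (4 * A) \<and> G = monom A 2 \<and>
      h = monom 1 (n1 div 2) + monom (B / (2 * A)) (n3 div 2)) \<or>
    (\<exists>c. c \<noteq> 0 \<and> n1 = 4 * n3 \<and> n2 = 3 * n3 \<and>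
      G = smult A ([:0, 1:] * ([:0, 1:] - [:c\<^sup>2:])) \<and> h = monom 1 (2 * n3) + monom c n3)"
proof -
  have deg_h: "0 < degree h"
    using h(1,2) by (cases "degree h = 0") auto
  have deg_F: "degree (monom A n1 + monom B n2 + monom C n3) = n1"
    using ABC n by (simp add: degree_add_eq_left degree_monom_eq)
  then have n1: "n1 = degree G * degree h"
    unfolding F by (simp add: degree_pcompose)
  have A: "lead_coeff G = A"
  proof -
    have "lead_coeff (G \<circ>\<^sub>p h) = lead_coeff G"
      using deg_h h(1) by (simp add: lead_coeff_comp)
    moreover have "lead_coeff (G \<circ>\<^sub>p h) = A"
      unfolding F[symmetric] deg_F using n by simp
    ultimately show ?thesis by simp
  qed
  have nz: "G \<noteq> 0" "h \<noteq> 0" using t deg_h by auto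
  have n3: "n3 = order 0 G * order 0 h"
    using order_0_trinomial[OF ABC(3) n(1,2), of A B] order_0_pcompose[OF nz h(2)] F by simp
  define S where "S = {i. i < degree h \<and> coeff h i \<noteq> 0}"
  have "S \<noteq> {}"
  proof
    assume "S = {}"
    then have "coeff h i = coeff (monom 1 (degree h)) i" for i
      using h(1) coeff_eq_0[of h i] linorder_less_linear[of i "degree h"] unfolding S_def by auto
    then show False using h(3) by (auto simp: poly_eq_iff)
  qed
  define j where "j = Max S"
  have "finite S" unfolding S_def by simp
  then have "j \<in> S" and max: "\<And>i. i \<in> S \<Longrightarrow> i \<le> j"
    using \<open>S \<noteq> {}\<close> unfolding j_def by auto
  then have "coeff h j \<noteq> 0" "j < degree h" unfolding S_def by auto
  moreover from this have "0 < j" using h(2) by (cases j) auto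
  moreover have "coeff h i = 0" if "j < i" "i < degree h" for i
    using that max[of i] unfolding S_def by auto
  ultimately have j: "0 < j" "j < degree h" "coeff h j \<noteq> 0"
    "\<And>i. j < i \<Longrightarrow> i < degree h \<Longrightarrow> coeff h i = 0" by blast+
  show ?thesis
  \<comment> \<open>Equality of order and degree means that \<open>G\<close> is a monomial.\<close>
  proof (cases "order 0 G < degree G")
    case True
    from trinomial_mixed[OF ABC n F h(1,2) n1 n3 t A True j] j(3) show ?thesis by blast
  next
    case False
    have "order 0 G \<le> degree G" using nz by (intro order_0_le) simp
    then have ord: "order 0 G = degree G" using False by simp
    have "coeff G i = coeff (monom A (degree G)) i" for i
      using A ord coeff_less_order_0[of i G] coeff_eq_0[of G i]
        linorder_less_linear[of i "degree G"] by auto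
    then have G: "G = monom A (degree G)" by (rule poly_eqI)
    have "monom A n1 + monom B n2 + monom C n3 = smult A (h ^ degree G)"
      unfolding F by (subst G) (rule pcompose_monom)
    note res = trinomial_pure_power[OF ABC n(1,2) this h(1) n1 n3[unfolded ord] t j]
    then have "degree G = 2" by blast
    with G have "G = monom A 2" by (simp only:)
    with res show ?thesis by blast
  qed
qed

section \<open>Linear substitutions and the reduction to normalized form\<close>

lemma pcompose_inject:
  fixes p q h :: "'a::idom poly"
  assumes "0 < degree h"
  shows "p \<circ>\<^sub>p h = q \<circ>\<^sub>p h \<longleftrightarrow> p = q"
  using pcompose_eq_0_iff[OF assms, of "p - q"] by (simp add: pcompose_diff)

lemma coeff_pcompose_monom:
  fixes p :: "'a::comm_semiring_1 poly"
  assumes "0 < d"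
  shows "coeff (p \<circ>\<^sub>p monom 1 d) i = (if d dvd i then coeff p (i div d) else 0)"
  using assms
proof (induction p arbitrary: i)
  case (pCons a p)
  then show ?case
    by (cases "i < d")
       (auto simp: pcompose_pCons coeff_monom_mult coeff_pCons div_eq_0_iff le_div_geq
         dvd_minus_self dest: dvd_imp_le split: nat.splits)
qed simp

lemma linear_poly_comp_inverse:
  assumes "linear_poly l"
  shows "linear_poly (comp_inverse l)"
proof -
  have "degree (l \<circ>\<^sub>p comp_inverse l) = 1"
    using comp_inverse_right[OF assms] by simp
  then show ?thesis using assms by (simp add: linear_poly_def degree_pcompose)
qed

text \<open>Lets the one normalizing \<open>l\<close> serve all conclusions, some of which need its
  inverse as witness.\<close>

lemma comp_inverse_comp_inverse:
  assumes "linear_poly l"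
  shows "comp_inverse (comp_inverse l) = l"
  unfolding comp_inverse_def[of "comp_inverse l"]
  using comp_inverse_unique_ex[OF linear_poly_comp_inverse[OF assms]]
    comp_inverse_left[OF assms] comp_inverse_right[OF assms]
  by (intro the1_equality) auto

lemma pcompose_comp_inverse_cancel:
  assumes "linear_poly l"
  shows "(p \<circ>\<^sub>p l) \<circ>\<^sub>p comp_inverse l = p" "comp_inverse l \<circ>\<^sub>p (l \<circ>\<^sub>p q) = q"
proof -
  show "(p \<circ>\<^sub>p l) \<circ>\<^sub>p comp_inverse l = p"
    by (simp add: comp_inverse_right[OF assms] flip: pcompose_assoc)
  show "comp_inverse l \<circ>\<^sub>p (l \<circ>\<^sub>p q) = q"
    by (simp add: comp_inverse_left[OF assms] pcompose_assoc pcompose_pCons)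
qed

theorem theorem2p5:
  fixes A B C D :: "'a::{alg_closed_field, field_char_0}"
    and f g h :: "'a poly"
    and n1 n2 n3 :: nat
  assumes "A * B * C \<noteq> 0"
    and "n1 > n2" and "n2 > n3" and "n3 > 0"
    and "f = monom A n1 + monom B n2 + monom C n3 + [:D:]"
    and "f = g \<circ>\<^sub>p h"
  shows
    "(\<exists>l d. linear_poly l \<and> d > 0 \<and> d dvd gcd n1 (gcd n2 n3) \<and>
        g = (monom A (n1 div d) + monom B (n2 div d) + monom C (n3 div d) + [:D:])
              \<circ>\<^sub>p comp_inverse l \<and>
        h = l \<circ>\<^sub>p monom 1 d) \<or>
     (\<exists>l. linear_poly l \<and> g = l \<and> h = comp_inverse l \<circ>\<^sub>p f) \<or>
     (\<exists>l. linear_poly l \<and> even n1 \<and> even n3 \<and>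
        g = (monom A 2 + [:D:]) \<circ>\<^sub>p l \<and>
        h = comp_inverse l \<circ>\<^sub>p (monom 1 (n1 div 2) + monom (B / (2 * A)) (n3 div 2)) \<and>
        2 * n2 = n1 + n3 \<and> C = B\<^sup>2 / (4 * A)) \<or>
     (\<exists>l c. linear_poly l \<and> c \<noteq> 0 \<and>
        g = (smult A ([:0, 1:] * ([:0, 1:] - [:c\<^sup>2:])) + [:D:]) \<circ>\<^sub>p l \<and>
        h = comp_inverse l \<circ>\<^sub>p (monom 1 (2 * n3) + monom c n3) \<and>
        n1 = 4 * n3 \<and> n2 = 3 * n3)"
    (is "?power \<or> ?linear \<or> ?square \<or> ?quartic")
proof -
  have ABC: "A \<noteq> 0" "B \<noteq> 0" "C \<noteq> 0" using assms(1) by auto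
  note n = assms(3,2,4)
  have "degree f = n1"
    using ABC n unfolding assms(5) by (simp add: degree_add_eq_left degree_monom_eq)
  then have deg: "degree g * degree h = n1"
    unfolding assms(6) by (simp add: degree_pcompose)
  then have deg_pos: "0 < degree g" "0 < degree h" using n by (auto intro: Nat.gr0I)
  \<comment> \<open>The map \<open>l\<close> absorbs the leading coefficient and the constant term
    of \<open>h\<close>, so that \<open>u\<close> is monic with \<open>u(0) = 0\<close>.\<close>
  define l u where "l = [:coeff h 0, lead_coeff h:]"
    and "u = smult (inverse (lead_coeff h)) (h - [:coeff h 0:])"
  have lc: "lead_coeff h \<noteq> 0" using deg_pos by auto
  then have l: "linear_poly l" by (simp add: l_def linear_poly_def)
  have hl: "h = l \<circ>\<^sub>p u" using lc by (simp add: l_def u_def pcompose_pCons)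
  have deg_u: "degree u = degree h"
    using arg_cong[OF hl, of degree] l by (simp add: degree_pcompose linear_poly_def)
  have u: "lead_coeff u = 1" "coeff u 0 = 0"
    using left_inverse[OF lc] deg_pos unfolding deg_u
    by (auto simp: u_def coeff_pCons split: nat.splits)
  define G where "G = g \<circ>\<^sub>p l - [:D:]"
  have Gu: "monom A n1 + monom B n2 + monom C n3 = G \<circ>\<^sub>p u"
    using assms(5,6) unfolding G_def hl by (simp add: pcompose_diff pcompose_assoc)
  have gG: "g \<circ>\<^sub>p l = G + [:D:]" unfolding G_def by simp
  then have g: "g = (G + [:D:]) \<circ>\<^sub>p comp_inverse l"
    using pcompose_comp_inverse_cancel(1)[OF l, of g] by simp
  note inv = comp_inverse_comp_inverse[OF l] linear_poly_comp_inverse[OF l]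
  consider "u = monom 1 (degree u)" | "degree g = 1" | "u \<noteq> monom 1 (degree u)" "2 \<le> degree g"
    using deg_pos by fastforce
  then show ?thesis
  proof cases
    case 1
    define d where "d = degree u"
    have d: "0 < d" "u = monom 1 d" using deg_pos deg_u 1 unfolding d_def by auto
    \<comment> \<open>Composition with \<open>monom 1 d\<close> produces only exponents divisible by
      \<open>d\<close>, so the non-zero \<open>A\<close>, \<open>B\<close>, \<open>C\<close> force
      \<open>d\<close> to divide all three exponents.\<close>
    have co: "coeff (monom A n1 + monom B n2 + monom C n3) i =
        (if d dvd i then coeff G (i div d) else 0)" for i
      unfolding Gu d(2) using d(1) by (rule coeff_pcompose_monom)
    have dvd: "d dvd n1" "d dvd n2" "d dvd n3"
      using co[of n1] co[of n2] co[of n3] ABC n by (auto split: if_splits)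
    have "(monom A (n1 div d) + monom B (n2 div d) + monom C (n3 div d)) \<circ>\<^sub>p u = G \<circ>\<^sub>p u"
      unfolding Gu[symmetric] using dvd
      by (simp add: d(2) pcompose_add pcompose_monom monom_power smult_monom)
    then have "G = monom A (n1 div d) + monom B (n2 div d) + monom C (n3 div d)"
      using deg_pos deg_u by (simp add: pcompose_inject)
    then have ?power using l d dvd g hl by (intro exI[of _ l] exI[of _ d]) auto
    then show ?thesis ..
  next
    case 2
    then have "linear_poly g" by (simp add: linear_poly_def)
    moreover from this have "h = comp_inverse g \<circ>\<^sub>p f"
      unfolding assms(6) by (simp add: pcompose_comp_inverse_cancel)
    ultimately show ?thesis by blast
  next
    case 3
    have "degree (G + [:D:]) = degree g"
      using l unfolding gG[symmetric] by (simp add: degree_pcompose linear_poly_def)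
    moreover have "degree (G + [:D:]) \<le> max (degree G) 0"
      using degree_add_le_max[of G "[:D:]"] by simp
    ultimately have "2 \<le> degree G" using 3(2) by simp
    from trinomial_decomposition_normalized[OF ABC n Gu u 3(1) this]
    consider (square) "even n1" "even n3" "2 * n2 = n1 + n3" "C = B\<^sup>2 / (4 * A)" "G = monom A 2"
        "u = monom 1 (n1 div 2) + monom (B / (2 * A)) (n3 div 2)"
      | (quartic) c where "c \<noteq> 0" "n1 = 4 * n3" "n2 = 3 * n3"
        "G = smult A ([:0, 1:] * ([:0, 1:] - [:c\<^sup>2:]))" "u = monom 1 (2 * n3) + monom c n3"
      by blast
    then show ?thesis
    proof cases
      case square
      \<comment> \<open>The linear polynomial asked for is \<open>comp_inverse l\<close>, since here
        it stands on the right of the outer factor without inversion.\<close>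
      have "g = (monom A 2 + [:D:]) \<circ>\<^sub>p comp_inverse l"
        using g unfolding square(5) .
      moreover have "h = comp_inverse (comp_inverse l) \<circ>\<^sub>p
          (monom 1 (n1 div 2) + monom (B / (2 * A)) (n3 div 2))"
        using hl unfolding inv(1) square(6) .
      ultimately show ?thesis using square(1-4) inv(2) by blast
    next
      case quartic
      have "g = (smult A ([:0, 1:] * ([:0, 1:] - [:c\<^sup>2:])) + [:D:]) \<circ>\<^sub>p comp_inverse l"
        using g unfolding quartic(4) .
      moreover have "h = comp_inverse (comp_inverse l) \<circ>\<^sub>p (monom 1 (2 * n3) + monom c n3)"
        using hl unfolding inv(1) quartic(5) .
      ultimately show ?thesis using quartic(1-3) inv(2) by blast
    qed
  qed
qed

end
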